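(* Let $q\in(0,1)$. If $f(z)=z+\sum_{n=2}^\infty a_nz^n$ belongs to $\mathcal{K}_q$ with the function $g(z)=z$, then for all $n\ge 2$ $$|a_n|\le\frac{1-q^2}{1-q^n}.$$
   Context: $\mathbb{D}=\{z\in\mathbb{C}:|z|<1\}$. $\mathcal{A}$ is the class of functions $f$ analytic in $\mathbb{D}$ with $f(0)=0=f'(0)-1$. $\mathcal{S}^*\subset\mathcal{A}$ is the class of univalent functions $g\in\mathcal{A}$ that are starlike with respect to the origin. For $q\in(0,1)$ and $f\in\mathcal{A}$, the $q$-difference operator is $(D_qf)(z)=\dfrac{f(z)-f(qz)}{z(1-q)}$ for $z\in\mathbb{D}\setminus\{0\}$, and $(D_qf)(0)=f'(0)$. A function $f\in\mathcal{A}$ belongs to $\mathcal{K}_q$ if there exists $g\in\mathcal{S}^*$ such that $$\left|\frac{z}{g(z)}(D_qf)(z)-\frac{1}{1-q}\right|\le\frac{1}{1-q},\quad z\in\mathbb{D}$$ (where $z/g(z)$ is given its limit value $1$ at $z=0$); one then says that $f\in\mathcal{K}_q$ with the function $g$. *)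

theory Defs
  imports "HOL-Complex_Analysis.Complex_Analysis"
begin

abbreviation unit_disc :: "complex set" where
  "unit_disc \<equiv> ball 0 1"

text \<open>Functions on the disc are total functions on the complex plane; their values outside
  \<^term>\<open>unit_disc\<close> are irrelevant to all the notions below (for \<open>0 < q < 1\<close>).\<close>

definition class_A :: "(complex \<Rightarrow> complex) set" where
  "class_A = {f. f analytic_on unit_disc \<and> f 0 = 0 \<and> deriv f 0 = 1}"

text \<open>The library's \<^const>\<open>starlike\<close> only asks for some centre; here the centre is prescribed.\<close>

definition starlike_wrt :: "'a::real_vector \<Rightarrow> 'a set \<Rightarrow> bool" where
  "starlike_wrt c S \<longleftrightarrow> c \<in> S \<and> (\<forall>x\<in>S. closed_segment c x \<subseteq> S)"

definition class_S_star :: "(complex \<Rightarrow> complex) set" where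
  "class_S_star = {g \<in> class_A. inj_on g unit_disc \<and> starlike_wrt 0 (g ` unit_disc)}"

definition q_diff :: "real \<Rightarrow> (complex \<Rightarrow> complex) \<Rightarrow> complex \<Rightarrow> complex" where
  "q_diff q f z =
     (if z = 0 then deriv f 0
      else (f z - f (of_real q * z)) / (z * (1 - of_real q)))"

text \<open>For \<open>g\<close> in \<^const>\<open>class_S_star\<close>, injectivity and \<open>g 0 = 0\<close> give \<open>g z \<noteq> 0\<close> on the punctured
  disc, so only the removable singularity of \<open>z / g z\<close> at \<open>0\<close>, with limit \<open>1\<close>, is filled in.\<close>

definition K_q_with :: "real \<Rightarrow> (complex \<Rightarrow> complex) \<Rightarrow> (complex \<Rightarrow> complex) \<Rightarrow> bool" where
  "K_q_with q f g \<longleftrightarrow>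
     f \<in> class_A \<and> g \<in> class_S_star \<and>
     (\<forall>z\<in>unit_disc.
        cmod ((if z = 0 then 1 else z / g z) * q_diff q f z - of_real (1 / (1 - q)))
          \<le> 1 / (1 - q))"

definition class_K_q :: "real \<Rightarrow> (complex \<Rightarrow> complex) set" where
  "class_K_q q = {f. \<exists>g. K_q_with q f g}"

end

theory Submission
  imports Defs
begin

text \<open>With \<open>g(z) = z\<close> the defining inequality of \<open>\<K>\<^sub>q\<close> says exactly that
  \<open>w(z) = 1 - (1 - q) (D\<^sub>q f)(z)\<close> maps the unit disc into the closed unit disc, and the power
  series of \<open>w\<close> is \<open>q - (\<Sum>k\<ge>1. (1 - q ^ (k + 1)) a\<^sub>k\<^sub>+\<^sub>1 z\<^sup>k)\<close>. Therefore the theorem is the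
  coefficient bound \<open>\<bar>c\<^sub>m\<bar> \<le> 1 - \<bar>c\<^sub>0\<bar>\<^sup>2\<close> for analytic functions bounded by \<open>1\<close>, lemma
  \<open>bounded_power_series_coeff_bound\<close>.

  For \<open>m = 1\<close> that bound is the infinitesimal Schwarz--Pick inequality at the origin. To reach
  general \<open>m\<close>, average the function over the rotations by the \<open>m\<close>-th roots of unity: the average
  is still bounded by \<open>1\<close>, and its series \<open>c\<^sub>0 + c\<^sub>m z\<^sup>m + c\<^sub>2\<^sub>m z\<^sup>2\<^sup>m + \<dots>\<close> retains only
  the exponents divisible by \<open>m\<close>. A Moebius map carrying \<open>c\<^sub>0\<close> to \<open>0\<close> then
  gives a function bounded by \<open>1\<close> with a zero of order at least \<open>m\<close> at the origin, to which the
  argument of the Schwarz lemma applies.\<close>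

lemma cmod_diff_le_cmod_one_minus_cnj_mult:
  fixes c u :: complex
  assumes "cmod c \<le> 1" "cmod u \<le> 1"
  shows "cmod (u - c) \<le> cmod (1 - cnj c * u)"
proof -
  have "(cmod (1 - cnj c * u))\<^sup>2 - (cmod (u - c))\<^sup>2 = (1 - (cmod c)\<^sup>2) * (1 - (cmod u)\<^sup>2)"
    by (simp only: cmod_power2) (simp add: power2_eq_square algebra_simps)
  moreover have "\<dots> \<ge> 0"
    using assms by (intro mult_nonneg_nonneg) (auto simp: abs_square_le_1)
  ultimately have "(cmod (u - c))\<^sup>2 \<le> (cmod (1 - cnj c * u))\<^sup>2"
    by linarith
  then show ?thesis
    by (rule power2_le_imp_le) simp
qed

text \<open>This is the Schwarz--Pick step: dividing the Moebius image of the function by \<open>z\<^sup>m\<close> leaves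
  a function whose value at the origin is \<open>c\<^sub>m / (1 - \<bar>c\<^sub>0\<bar>\<^sup>2)\<close> and which is bounded by
  \<open>1 / r\<^sup>m\<close> on the circle of radius \<open>r\<close>, for every \<open>r < 1\<close>.\<close>

lemma bounded_power_series_coeff_bound_gap:
  fixes c :: "nat \<Rightarrow> complex"
  assumes sums: "\<And>z. z \<in> ball 0 1 \<Longrightarrow> (\<lambda>k. c k * z ^ k) sums F z"
    and bdd: "\<And>z. z \<in> ball 0 1 \<Longrightarrow> cmod (F z) \<le> 1"
    and c0: "cmod (c 0) < 1" and "0 < m"
    and gap: "\<And>k. 0 < k \<Longrightarrow> k < m \<Longrightarrow> c k = 0"
  shows "cmod (c m) \<le> 1 - (cmod (c 0))\<^sup>2"
proof -
  define G where "G = (\<lambda>z. \<Sum>k. c (k + m) * z ^ k)"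
  have split: "(\<Sum>k<m. c k * z ^ k) = c 0" for z
  proof -
    have "(\<Sum>k<m. c k * z ^ k) = (\<Sum>k\<in>{0}. c k * z ^ k)"
      using \<open>0 < m\<close> gap by (intro sum.mono_neutral_right) auto
    then show ?thesis by simp
  qed
  have shifted: "(\<lambda>k. c (k + m) * z ^ (k + m)) sums (F z - c 0)" if "z \<in> ball 0 1" for z
    using sums_split_initial_segment[OF sums[OF that], of m] by (simp add: split)
  have Gsums: "(\<lambda>k. c (k + m) * z ^ k) sums G z" if "z \<in> ball 0 1" for z
  proof (cases "z = 0")
    case True
    then show ?thesis
      unfolding G_def by (intro summable_sums sums_summable[of _ "c m"])
        (use powser_sums_zero[of "\<lambda>k. c (k + m)"] in simp)
  next
    case False
    have "(\<lambda>k. c (k + m) * z ^ (k + m) / z ^ m) sums ((F z - c 0) / z ^ m)"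
      by (intro sums_divide shifted that)
    then show ?thesis
      using False unfolding G_def
      by (intro summable_sums) (auto simp: power_add sums_iff)
  qed
  have G0: "G 0 = c m"
    using powser_sums_zero[of "\<lambda>k. c (k + m)"] by (simp add: G_def sums_iff)
  have factor: "F z - c 0 = z ^ m * G z" if "z \<in> ball 0 1" for z
  proof (rule sums_unique2[OF shifted[OF that]])
    show "(\<lambda>k. c (k + m) * z ^ (k + m)) sums (z ^ m * G z)"
      using sums_mult[OF Gsums[OF that], of "z ^ m"] by (simp add: power_add mult_ac)
  qed
  have "G holomorphic_on ball 0 1"
    using power_series_holomorphic[of 0 1 "\<lambda>k. c (k + m)" G] Gsums by simp
  moreover have "F holomorphic_on ball 0 1"
    using power_series_holomorphic[of 0 1 c F] sums by simp
  moreover have nz: "1 - cnj (c 0) * F z \<noteq> 0" if "z \<in> ball 0 1" for z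
  proof
    assume "1 - cnj (c 0) * F z = 0"
    then have "cmod (cnj (c 0) * F z) = 1" by simp
    moreover have "cmod (cnj (c 0) * F z) \<le> cmod (c 0) * 1"
      using bdd[OF that] by (simp add: norm_mult mult_left_le)
    ultimately show False using c0 by simp
  qed
  define P where "P = (\<lambda>z. G z / (1 - cnj (c 0) * F z))"
  ultimately have P_hol: "P holomorphic_on ball 0 1"
    unfolding P_def by (intro holomorphic_intros) (use nz in blast)+
  have "r ^ m * cmod (P 0) \<le> 1" if r: "0 < r" "r < 1" for r :: real
  proof -
    have "cmod (P z) \<le> 1 / r ^ m" if "cmod z = r" for z
    proof -
      have z: "z \<in> ball 0 1" using that r by simp
      have "r ^ m * cmod (G z) = cmod (F z - c 0)"
        using factor[OF z] that by (simp add: norm_mult norm_power)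
      also have "\<dots> \<le> cmod (1 - cnj (c 0) * F z)"
        using c0 bdd[OF z] by (intro cmod_diff_le_cmod_one_minus_cnj_mult) auto
      finally show ?thesis
        using r nz[OF z] by (simp add: P_def norm_divide field_simps)
    qed
    moreover have "P holomorphic_on cball 0 r"
      using P_hol by (rule holomorphic_on_subset) (use r in auto)
    ultimately have "cmod ((deriv ^^ 0) P 0) \<le> fact 0 * (1 / r ^ m) / r ^ 0"
      using r by (intro Cauchy_inequality)
        (auto intro: holomorphic_on_subset holomorphic_on_imp_continuous_on)
    then show ?thesis
      using r by (simp add: field_simps)
  qed
  then have "eventually (\<lambda>r. r ^ m * cmod (P 0) \<le> 1) (at_left 1)"
    by (intro eventually_at_leftI[of 0]) auto
  moreover have "((\<lambda>r. r ^ m * cmod (P 0)) \<longlongrightarrow> 1 ^ m * cmod (P 0)) (at_left (1::real))"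
    by (intro tendsto_intros)
  ultimately have "1 ^ m * cmod (P 0) \<le> 1"
    using tendsto_upperbound[of _ _ "at_left (1::real)"] by force
  moreover have "F 0 = c 0"
    using factor[of 0] \<open>0 < m\<close> by (simp add: power_0_left)
  then have "cmod (P 0) = cmod (c m) / (1 - (cmod (c 0))\<^sup>2)"
  proof -
    have "1 - cnj (c 0) * c 0 = of_real (1 - (cmod (c 0))\<^sup>2)"
      by (metis complex_norm_square mult.commute of_real_1 of_real_diff)
    moreover have "(cmod (c 0))\<^sup>2 < 1"
      using c0 by (simp add: abs_square_less_1)
    ultimately show ?thesis
      by (simp only: P_def G0 \<open>F 0 = c 0\<close> norm_divide norm_of_real)
  qed
  moreover have "(cmod (c 0))\<^sup>2 < 1"
    using c0 by (simp add: abs_square_less_1)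
  ultimately show ?thesis
    by (simp add: field_simps)
qed

lemma sum_powers_root_of_unity:
  assumes "0 < m"
  shows "(\<Sum>i<m. (exp (2 * of_real pi * \<i> * of_nat i / of_nat m)) ^ k)
       = (if m dvd k then of_nat m else 0)"
proof -
  define x :: complex where "x = exp (2 * of_real pi * \<i> * of_nat k / of_nat m)"
  have "(exp (2 * of_real pi * \<i> * of_nat i / of_nat m)) ^ k = x ^ i" for i
    by (simp add: x_def mult_ac flip: exp_of_nat_mult)
  moreover have "x = 1 \<longleftrightarrow> m dvd k"
    unfolding x_def using assms by (intro complex_root_unity_eq_1) simp
  moreover have "x ^ m = 1"
  proof -
    have "x ^ m = exp (2 * of_real pi * \<i> * of_nat k)"
      using assms by (simp add: x_def flip: exp_of_nat_mult)
    also have "\<dots> = 1"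
      by (simp add: exp_eq_1) (metis of_int_of_nat_eq)
    finally show ?thesis .
  qed
  ultimately show ?thesis
    by (auto simp: sum_gp_strict)
qed

text \<open>Averaging over the rotations by \<open>m\<close>-th roots of unity annihilates the coefficients with index
  not divisible by \<open>m\<close>, in particular those strictly between \<open>0\<close> and \<open>m\<close>, and preserves the bound,
  since the disc is convex.\<close>

lemma bounded_power_series_coeff_bound:
  fixes c :: "nat \<Rightarrow> complex"
  assumes sums: "\<And>z. z \<in> ball 0 1 \<Longrightarrow> (\<lambda>k. c k * z ^ k) sums F z"
    and bdd: "\<And>z. z \<in> ball 0 1 \<Longrightarrow> cmod (F z) \<le> 1"
    and c0: "cmod (c 0) < 1" and m: "0 < m"
  shows "cmod (c m) \<le> 1 - (cmod (c 0))\<^sup>2"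
proof -
  define \<omega> :: "nat \<Rightarrow> complex" where
    "\<omega> = (\<lambda>i. exp (2 * of_real pi * \<i> * of_nat i / of_nat m))"
  define d where "d = (\<lambda>k. if m dvd k then c k else 0)"
  define F' where "F' = (\<lambda>z. (\<Sum>i<m. F (\<omega> i * z)) / of_nat m)"
  have norm_\<omega>: "cmod (\<omega> i) = 1" for i
    by (simp add: \<omega>_def)
  have "cmod (d m) \<le> 1 - (cmod (d 0))\<^sup>2"
  proof (rule bounded_power_series_coeff_bound_gap)
    fix z :: complex assume z: "z \<in> ball 0 1"
    then have rot: "\<omega> i * z \<in> ball 0 1" for i
      by (simp add: norm_mult norm_\<omega>)
    have "(\<lambda>k. (\<Sum>i<m. c k * (\<omega> i * z) ^ k) / of_nat m) sums F' z"
      unfolding F'_def by (intro sums_divide sums_sum sums rot)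
    also have "(\<lambda>k. (\<Sum>i<m. c k * (\<omega> i * z) ^ k) / of_nat m) = (\<lambda>k. d k * z ^ k)"
    proof
      fix k
      have "(\<Sum>i<m. c k * (\<omega> i * z) ^ k) = c k * z ^ k * (\<Sum>i<m. \<omega> i ^ k)"
        by (simp add: sum_distrib_left power_mult_distrib mult_ac)
      then show "(\<Sum>i<m. c k * (\<omega> i * z) ^ k) / of_nat m = d k * z ^ k"
        using m by (simp add: \<omega>_def sum_powers_root_of_unity d_def)
    qed
    finally show "(\<lambda>k. d k * z ^ k) sums F' z" .
    have "cmod (\<Sum>i<m. F (\<omega> i * z)) \<le> of_nat (card {..<m}) * 1"
      by (intro sum_norm_bound bdd rot)
    then show "cmod (F' z) \<le> 1"
      using m by (simp add: F'_def norm_divide)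
  qed (use c0 m in \<open>auto simp: d_def dest: dvd_imp_le\<close>)
  then show ?thesis
    by (simp add: d_def)
qed

theorem corollary3p4:
  fixes q :: real and f :: "complex \<Rightarrow> complex" and a :: "nat \<Rightarrow> complex"
  assumes "0 < q" and "q < 1"
    and "\<And>z. z \<in> unit_disc \<Longrightarrow> (\<lambda>n. a (n + 2) * z ^ (n + 2)) sums (f z - z)"
    and "K_q_with q f (\<lambda>z. z)"
  shows "\<forall>n\<ge>2. cmod (a n) \<le> (1 - q ^ 2) / (1 - q ^ n)"
proof (intro allI impI)
  fix n :: nat assume n: "n \<ge> 2"
  define w where "w = (\<lambda>z. 1 - of_real (1 - q) * q_diff q f z)"
  define c where "c = (\<lambda>k. if k = 0 then of_real q else - (1 - of_real q ^ (k + 1)) * a (k + 1))"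
  have "f \<in> class_A" and K: "\<And>z. z \<in> unit_disc \<Longrightarrow>
      cmod ((if z = 0 then 1 else z / z) * q_diff q f z - of_real (1 / (1 - q))) \<le> 1 / (1 - q)"
    using assms(4) unfolding K_q_with_def by auto
  then have df: "deriv f 0 = 1"
    by (simp add: class_A_def)
  have "cmod (c (n - 1)) \<le> 1 - (cmod (c 0))\<^sup>2"
  proof (rule bounded_power_series_coeff_bound)
    fix z :: complex assume z: "z \<in> unit_disc"
    have "1 / (1 - q) \<ge> cmod (q_diff q f z - of_real (1 / (1 - q)))"
      using K[OF z] by (cases "z = 0") auto
    then have "(1 - q) * cmod (q_diff q f z - of_real (1 / (1 - q))) \<le> 1"
      using \<open>q < 1\<close> by (simp add: field_simps)
    also have "(1 - q) * cmod (q_diff q f z - of_real (1 / (1 - q)))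
        = cmod (of_real (1 - q) * (q_diff q f z - of_real (1 / (1 - q))))"
      using \<open>q < 1\<close> by (simp only: norm_mult norm_of_real)
    also have "of_real (1 - q) * (q_diff q f z - of_real (1 / (1 - q))) = - w z"
    proof -
      have "of_real (1 - q) * of_real (1 / (1 - q)) = (1 :: complex)"
        using \<open>q < 1\<close> by (simp flip: of_real_mult)
      then show ?thesis
        by (simp only: w_def right_diff_distrib) simp
    qed
    finally show "cmod (w z) \<le> 1" by simp
    show "(\<lambda>k. c k * z ^ k) sums w z"
    proof (cases "z = 0")
      case True
      have "w 0 = c 0" by (simp add: w_def c_def q_diff_def df)
      then show ?thesis
        using True powser_sums_zero[of c] by simp
    next
      case False
      have "cmod (of_real q * z) < 1"
        using z assms(1,2) mult_strict_mono[of q 1 "cmod z" 1] by (simp add: norm_mult)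
      then have qz: "of_real q * z \<in> unit_disc" by simp
      have "(\<lambda>k. - ((a (k + 2) * z ^ (k + 2) - a (k + 2) * (of_real q * z) ^ (k + 2)) / z))
          sums - ((f z - z - (f (of_real q * z) - of_real q * z)) / z)"
        by (intro sums_minus sums_divide sums_diff assms(3) z qz)
      also have "(\<lambda>k. - ((a (k + 2) * z ^ (k + 2) - a (k + 2) * (of_real q * z) ^ (k + 2)) / z))
          = (\<lambda>k. c (Suc k) * z ^ Suc k)"
        using False by (intro ext) (simp add: c_def power_mult_distrib field_simps)
      also have "- ((f z - z - (f (of_real q * z) - of_real q * z)) / z) = w z - c 0 * z ^ 0"
      proof -
        have "(1 :: complex) - of_real q \<noteq> 0"
          using \<open>q < 1\<close> by (simp add: complex_eq_iff)
        then have "w z = 1 - (f z - f (of_real q * z)) / z"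
          using False by (simp add: w_def q_diff_def)
        then show ?thesis
          using False by (simp add: c_def field_simps)
      qed
      finally show ?thesis
        using sums_Suc_iff[of "\<lambda>k. c k * z ^ k"] by simp
    qed
  qed (use assms(1,2) n in \<open>auto simp: c_def\<close>)
  moreover have "q ^ n < 1"
    using assms(1,2) n by (simp add: power_Suc_less_one power_less_one_iff)
  moreover have "cmod (c (n - 1)) = (1 - q ^ n) * cmod (a n)"
  proof -
    have "c (n - 1) = of_real (- (1 - q ^ n)) * a n"
      using n by (simp add: c_def)
    then show ?thesis
      using \<open>q ^ n < 1\<close> by (simp only: norm_mult norm_of_real)
  qed
  ultimately show "cmod (a n) \<le> (1 - q ^ 2) / (1 - q ^ n)"
    using assms(1) by (simp add: c_def field_simps)
qed

end
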